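(* Let $k$ be an ordered field equipped with the identity conjugation. For each nonnegative integer $i$ choose a negative $D_i\in k$, and recursively define the $k$-algebras $k^i$, $i\ge 0$, by $k^0=k$ and $k^i=k^{i-1}\times^{D_i}k^{i-1}$ for $i\ge 1$. Then, for all $i\ge 1$, an element $a\in k^i$ satisfies $n(a)=1$ if and only if there is a nonzero $b\in k^i$ satisfying $\overline{b}a=b$.
   Context: Let $k$ be a field. A $k$-algebra $K$ (not assumed commutative, associative or distributive) is a left $k$-vector space equipped with a multiplication and a multiplicative identity $1$ such that: $k$ is a subset of the center of $K$, and the additive and multiplicative structure on $k$ is the restriction of that on $K$; and $a(bc)=(ab)c$ for $a,b,c\in K$ whenever at least one of $a,b,c$ belongs to $k$. A conjugation on $K$ is a self-inverse $k$-linear map $\overline{\phantom{a}}:K\to K$ restricting to the identity on $k$. The norm is $n(a)=\overline{a}a$. $K$ is a division algebra over $k$ if for each nonzero $a\in K$ there is a unique $b\in K$ with $ab=ba=1$; then $b$ is written $a^{-1}$. Given a $k$-algebra $K$ with conjugation which is a division algebra, and $D\in k$, the Conway-Smith double $K\times^D K$ is the $k$-vector space $K\times K$ with conjugation $\overline{(a,b)}=(\overline{a},-b)$ and multiplication, for $a,b,c,d\in K$, $$(a,b)(c,d)=\left(ac+D\,\overline{b\,\overline{d}}\,,\ \overline{\overline{b}\;\overline{c}}+\overline{\overline{b}\;\overline{\overline{a}\;\overline{\overline{b^{-1}}\;\overline{d}}}}\right)\quad\text{if } b\ne 0,$$ and $(a,b)(c,d)=(ac,\overline{a}d)$ if $b=0$.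 It is a $k$-algebra with identity $(1,0)$; $K$ (and hence $k$) is regarded as contained in it via $a\mapsto(a,0)$. In the situation of the claim each $k^i$ is a division algebra with $a^{-1}=\overline{a}\,n(a)^{-1}$, so the recursion makes sense. $k$ is ordered if it carries a total order $\le$ such that $a\le b$ implies $a+c\le b+c$, and $0\le a$, $0\le b$ imply $0\le ab$. An element is negative if it is $\le 0$ and nonzero. *)

theory Defs
  imports Main
begin

record ('k, 'a) conj_algebra =
  alg_carrier :: "'a set"
  alg_zero :: 'a ("\<zero>\<index>")
  alg_one :: 'a ("\<one>\<index>")
  alg_add :: "'a \<Rightarrow> 'a \<Rightarrow> 'a" (infixl "\<oplus>\<index>" 65)
  alg_neg :: "'a \<Rightarrow> 'a" ("\<ominus>\<index> _" [81] 80)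
  alg_scale :: "'k \<Rightarrow> 'a \<Rightarrow> 'a" (infixr "\<odot>\<index>" 75)
  alg_mult :: "'a \<Rightarrow> 'a \<Rightarrow> 'a" (infixl "\<otimes>\<index>" 70)
  alg_conj :: "'a \<Rightarrow> 'a" ("cj\<index>")

definition alg_norm :: "('k, 'a, 'm) conj_algebra_scheme \<Rightarrow> 'a \<Rightarrow> 'a" where
  "alg_norm K a = cj\<^bsub>K\<^esub> a \<otimes>\<^bsub>K\<^esub> a"

text \<open>The two-sided inverse; meaningful for nonzero elements of a division algebra, where it exists
  and is unique by definition.\<close>

definition alg_inv :: "('k, 'a, 'm) conj_algebra_scheme \<Rightarrow> 'a \<Rightarrow> 'a" where
  "alg_inv K a = (THE b. b \<in> alg_carrier K \<and> a \<otimes>\<^bsub>K\<^esub> b = \<one>\<^bsub>K\<^esub> \<and> b \<otimes>\<^bsub>K\<^esub> a = \<one>\<^bsub>K\<^esub>)"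

text \<open>
  All algebras of the tower live in the single type below, so that the tower can be defined by
  recursion over the natural numbers: \<open>Couple a b\<close> plays the role of the pair \<open>(a, b)\<close>, and the
  carrier of the \<open>i\<close>-th algebra consists of the complete binary trees of depth \<open>i\<close>. The operations
  on couples are left unspecified on arguments that are not couples; these are never in the carrier.
\<close>

datatype 'k tree = Scalar 'k | Couple "'k tree" "'k tree"

fun double_add :: "('k, 'k tree) conj_algebra \<Rightarrow> 'k tree \<Rightarrow> 'k tree \<Rightarrow> 'k tree" where
  "double_add K (Couple a b) (Couple c d) = Couple (a \<oplus>\<^bsub>K\<^esub> c) (b \<oplus>\<^bsub>K\<^esub> d)"

fun double_neg :: "('k, 'k tree) conj_algebra \<Rightarrow> 'k tree \<Rightarrow> 'k tree" where
  "double_neg K (Couple a b) = Couple (\<ominus>\<^bsub>K\<^esub> a) (\<ominus>\<^bsub>K\<^esub> b)"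

fun double_scale :: "('k, 'k tree) conj_algebra \<Rightarrow> 'k \<Rightarrow> 'k tree \<Rightarrow> 'k tree" where
  "double_scale K r (Couple a b) = Couple (r \<odot>\<^bsub>K\<^esub> a) (r \<odot>\<^bsub>K\<^esub> b)"

fun double_conj :: "('k, 'k tree) conj_algebra \<Rightarrow> 'k tree \<Rightarrow> 'k tree" where
  "double_conj K (Couple a b) = Couple (cj\<^bsub>K\<^esub> a) (\<ominus>\<^bsub>K\<^esub> b)"

text \<open>Multiplication by the element \<open>D\<close> of the ground field is rendered by the scalar action.\<close>

fun double_mult :: "'k \<Rightarrow> ('k, 'k tree) conj_algebra \<Rightarrow> 'k tree \<Rightarrow> 'k tree \<Rightarrow> 'k tree" where
  "double_mult D K (Couple a b) (Couple c d) =
    (if b \<noteq> \<zero>\<^bsub>K\<^esub> then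
       Couple
         (a \<otimes>\<^bsub>K\<^esub> c \<oplus>\<^bsub>K\<^esub> D \<odot>\<^bsub>K\<^esub> cj\<^bsub>K\<^esub> (b \<otimes>\<^bsub>K\<^esub> cj\<^bsub>K\<^esub> d))
         (cj\<^bsub>K\<^esub> (cj\<^bsub>K\<^esub> b \<otimes>\<^bsub>K\<^esub> cj\<^bsub>K\<^esub> c) \<oplus>\<^bsub>K\<^esub>
          cj\<^bsub>K\<^esub> (cj\<^bsub>K\<^esub> b \<otimes>\<^bsub>K\<^esub>
            cj\<^bsub>K\<^esub> (cj\<^bsub>K\<^esub> a \<otimes>\<^bsub>K\<^esub>
              cj\<^bsub>K\<^esub> (cj\<^bsub>K\<^esub> (alg_inv K b) \<otimes>\<^bsub>K\<^esub> cj\<^bsub>K\<^esub> d))))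
     else Couple (a \<otimes>\<^bsub>K\<^esub> c) (cj\<^bsub>K\<^esub> a \<otimes>\<^bsub>K\<^esub> d))"

definition conway_smith_double ::
  "'k \<Rightarrow> ('k, 'k tree) conj_algebra \<Rightarrow> ('k, 'k tree) conj_algebra" where
  "conway_smith_double D K =
    \<lparr>alg_carrier = {Couple a b | a b. a \<in> alg_carrier K \<and> b \<in> alg_carrier K},
     alg_zero = Couple \<zero>\<^bsub>K\<^esub> \<zero>\<^bsub>K\<^esub>,
     alg_one = Couple \<one>\<^bsub>K\<^esub> \<zero>\<^bsub>K\<^esub>,
     alg_add = double_add K,
     alg_neg = double_neg K,
     alg_scale = double_scale K,
     alg_mult = double_mult D K,
     alg_conj = double_conj K\<rparr>"

fun scalar_op :: "('k \<Rightarrow> 'k \<Rightarrow> 'k) \<Rightarrow> 'k tree \<Rightarrow> 'k tree \<Rightarrow> 'k tree" where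
  "scalar_op f (Scalar x) (Scalar y) = Scalar (f x y)"

definition base_algebra :: "('k::field, 'k tree) conj_algebra" where
  "base_algebra =
    \<lparr>alg_carrier = range Scalar,
     alg_zero = Scalar 0,
     alg_one = Scalar 1,
     alg_add = scalar_op (+),
     alg_neg = scalar_op (-) (Scalar 0),
     alg_scale = (\<lambda>r. scalar_op (*) (Scalar r)),
     alg_mult = scalar_op (*),
     alg_conj = (\<lambda>x. x)\<rparr>"

text \<open>The parameter \<open>D 0\<close> is not used: the step from level \<open>i\<close> to level \<open>i + 1\<close> takes \<open>D (i + 1)\<close>.\<close>

primrec tower :: "(nat \<Rightarrow> 'k::field) \<Rightarrow> nat \<Rightarrow> ('k, 'k tree) conj_algebra" where
  "tower D 0 = base_algebra"
| "tower D (Suc i) = conway_smith_double (D (Suc i)) (tower D i)"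

end

theory Submission
  imports Defs
begin

text \<open>
  Every algebra of the tower carries a positive definite symmetric bilinear form \<open>B\<close> with
  \<open>n(a) = B a a\<close>, such that left multiplication by \<open>cj a\<close> is the adjoint of left multiplication
  by \<open>a\<close> and also \<open>n(a)\<close> times its inverse. These properties pass to the double: the operator
  \<open>T b x = cj (b (cj x))\<close> satisfies the same two laws, and for nonzero \<open>b\<close> the product is
  \<open>(a, b) (c, d) = (a c + D T b d, T (cj b) (c + n(b)\<inverse> (cj a) (T b d)))\<close>.
  Hence the norm is multiplicative, so \<open>(cj b) a = b\<close> with \<open>b \<noteq> 0\<close> forces \<open>n(a) = 1\<close>.
  Conversely, if \<open>n(a) = 1\<close> then \<open>b = 1 + a\<close> satisfies \<open>b b = n(b) a\<close>, and multiplying by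
  \<open>cj b\<close> on the left gives \<open>(cj b) a = b\<close> unless \<open>b = 0\<close>. For \<open>a = -1\<close> any nonzero \<open>b\<close> with
  \<open>cj b = -b\<close> will do.
\<close>

text \<open>
  The vector space laws are not assumed: as \<open>B\<close> is definite, an identity between elements follows
  once both sides have the same pairing with every element, which turns it into field arithmetic.
\<close>

locale euclidean_conj_algebra =
  fixes K :: "('k::linordered_field, 'a) conj_algebra" (structure)
    and B :: "'a \<Rightarrow> 'a \<Rightarrow> 'k"
  assumes zero_closed [simp]: "\<zero> \<in> alg_carrier K"
    and one_closed [simp]: "\<one> \<in> alg_carrier K"
    and add_closed [simp]: "\<lbrakk>x \<in> alg_carrier K; y \<in> alg_carrier K\<rbrakk> \<Longrightarrow> x \<oplus> y \<in> alg_carrier K"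
    and neg_closed [simp]: "x \<in> alg_carrier K \<Longrightarrow> \<ominus> x \<in> alg_carrier K"
    and scale_closed [simp]: "x \<in> alg_carrier K \<Longrightarrow> r \<odot> x \<in> alg_carrier K"
    and mult_closed [simp]: "\<lbrakk>x \<in> alg_carrier K; y \<in> alg_carrier K\<rbrakk> \<Longrightarrow> x \<otimes> y \<in> alg_carrier K"
    and eq_if_diff_zero: "\<lbrakk>x \<in> alg_carrier K; y \<in> alg_carrier K; x \<oplus> \<ominus> y = \<zero>\<rbrakk> \<Longrightarrow> x = y"
    and form_sym: "\<lbrakk>x \<in> alg_carrier K; y \<in> alg_carrier K\<rbrakk> \<Longrightarrow> B x y = B y x"
    and form_zero [simp]: "z \<in> alg_carrier K \<Longrightarrow> B \<zero> z = 0"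
    and form_add [simp]: "\<lbrakk>x \<in> alg_carrier K; y \<in> alg_carrier K; z \<in> alg_carrier K\<rbrakk>
      \<Longrightarrow> B (x \<oplus> y) z = B x z + B y z"
    and form_neg [simp]: "\<lbrakk>x \<in> alg_carrier K; z \<in> alg_carrier K\<rbrakk> \<Longrightarrow> B (\<ominus> x) z = - B x z"
    and form_scale [simp]: "\<lbrakk>x \<in> alg_carrier K; z \<in> alg_carrier K\<rbrakk> \<Longrightarrow> B (r \<odot> x) z = r * B x z"
    and form_pos: "\<lbrakk>x \<in> alg_carrier K; x \<noteq> \<zero>\<rbrakk> \<Longrightarrow> 0 < B x x"
    and form_one [simp]: "B \<one> \<one> = 1"
    and conj_trace: "x \<in> alg_carrier K \<Longrightarrow> cj x = (2 * B \<one> x) \<odot> \<one> \<oplus> \<ominus> x"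
    and mult_one [simp]: "x \<in> alg_carrier K \<Longrightarrow> x \<otimes> \<one> = x"
    and scale_mult [simp]: "\<lbrakk>x \<in> alg_carrier K; y \<in> alg_carrier K\<rbrakk> \<Longrightarrow> (r \<odot> x) \<otimes> y = r \<odot> (x \<otimes> y)"
    and mult_adjoint: "\<lbrakk>x \<in> alg_carrier K; y \<in> alg_carrier K; z \<in> alg_carrier K\<rbrakk>
      \<Longrightarrow> B (x \<otimes> y) z = B y (cj x \<otimes> z)"
    and conj_mult_cancel [simp]: "\<lbrakk>x \<in> alg_carrier K; y \<in> alg_carrier K\<rbrakk>
      \<Longrightarrow> cj x \<otimes> (x \<otimes> y) = B x x \<odot> y"
begin

section \<open>Conjugation, multiplication and inverses\<close>

lemma conj_closed [simp]: "x \<in> alg_carrier K \<Longrightarrow> cj x \<in> alg_carrier K"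
  by (simp add: conj_trace)

lemma form_right [simp]:
  assumes "x \<in> alg_carrier K" "y \<in> alg_carrier K" "z \<in> alg_carrier K"
  shows "B z \<zero> = 0" "B z (x \<oplus> y) = B z x + B z y" "B z (\<ominus> x) = - B z x" "B z (r \<odot> x) = r * B z x"
  using assms by (simp_all add: form_sym [of z])

lemma form_eqI:
  assumes "x \<in> alg_carrier K" "y \<in> alg_carrier K" "\<And>z. z \<in> alg_carrier K \<Longrightarrow> B x z = B y z"
  shows "x = y"
proof -
  have "B (x \<oplus> \<ominus> y) (x \<oplus> \<ominus> y) = 0"
    using assms by simp
  then have "x \<oplus> \<ominus> y = \<zero>"
    using form_pos [of "x \<oplus> \<ominus> y"] assms(1,2) by auto
  then show ?thesis
    using assms(1,2) by (rule eq_if_diff_zero [rotated 2])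
qed

lemma scale_cancel:
  assumes "x \<in> alg_carrier K" "y \<in> alg_carrier K" "r \<noteq> 0" "r \<odot> x = r \<odot> y"
  shows "x = y"
proof (rule form_eqI)
  fix z assume "z \<in> alg_carrier K"
  then have "r * B x z = r * B y z"
    using assms by (metis form_scale)
  then show "B x z = B y z"
    using assms(3) by simp
qed (use assms in simp_all)

lemma one_neq_zero: "\<one> \<noteq> \<zero>"
  using form_one form_zero [of \<one>] by force

lemma form_nonneg: "x \<in> alg_carrier K \<Longrightarrow> 0 \<le> B x x"
  using form_pos [of x] by (cases "x = \<zero>") auto

text \<open>By \<open>conj_trace\<close>, conjugation is the orthogonal reflection fixing 1 and
  negating its complement, hence self-adjoint.\<close>

lemma form_conj: "\<lbrakk>x \<in> alg_carrier K; y \<in> alg_carrier K\<rbrakk> \<Longrightarrow> B (cj x) y = B x (cj y)"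
  by (simp add: conj_trace form_sym [of x \<one>])

lemma conj_conj [simp]: "x \<in> alg_carrier K \<Longrightarrow> cj (cj x) = x"
  by (rule form_eqI) (simp_all add: conj_trace algebra_simps)

lemma conj_one [simp]: "cj \<one> = \<one>"
  by (rule form_eqI) (simp_all add: conj_trace)

lemma conj_zero [simp]: "cj \<zero> = \<zero>"
  by (rule form_eqI) (simp_all add: conj_trace)

lemma conj_linear:
  assumes "x \<in> alg_carrier K" "y \<in> alg_carrier K"
  shows "cj (x \<oplus> y) = cj x \<oplus> cj y" "cj (r \<odot> x) = r \<odot> cj x" "cj (\<ominus> x) = \<ominus> cj x"
  using assms by (intro form_eqI; simp add: conj_trace algebra_simps)+

lemma form_conj_conj [simp]: "\<lbrakk>x \<in> alg_carrier K; y \<in> alg_carrier K\<rbrakk> \<Longrightarrow> B (cj x) (cj y) = B x y"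
  by (simp add: form_conj)

text \<open>Left multiplication by \<open>x\<close> has an adjoint for a definite form, which forces
  linearity. In the left factor only homogeneity (\<open>scale_mult\<close>) is at hand.\<close>

lemma mult_linear:
  assumes "x \<in> alg_carrier K" "y \<in> alg_carrier K" "z \<in> alg_carrier K"
  shows "x \<otimes> (y \<oplus> z) = x \<otimes> y \<oplus> x \<otimes> z" "x \<otimes> (r \<odot> y) = r \<odot> (x \<otimes> y)"
    "x \<otimes> (\<ominus> y) = \<ominus> (x \<otimes> y)" "x \<otimes> \<zero> = \<zero>"
  using assms by (intro form_eqI; simp add: mult_adjoint)+

lemma neg_mult: "\<lbrakk>x \<in> alg_carrier K; y \<in> alg_carrier K\<rbrakk> \<Longrightarrow> (\<ominus> x) \<otimes> y = \<ominus> (x \<otimes> y)"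
proof -
  assume "x \<in> alg_carrier K" "y \<in> alg_carrier K"
  \<comment> \<open>Lacking additivity in the left factor, the sign is pulled out as the scalar
    -1.\<close>
  moreover from this have "\<ominus> x = (-1) \<odot> x"
    by (intro form_eqI) simp_all
  ultimately show ?thesis
    by (intro form_eqI) simp_all
qed

lemma conj_mult_cancel' [simp]:
  "\<lbrakk>x \<in> alg_carrier K; y \<in> alg_carrier K\<rbrakk> \<Longrightarrow> x \<otimes> (cj x \<otimes> y) = B x x \<odot> y"
  using conj_mult_cancel [of "cj x" y] by simp

lemma norm_eq: "x \<in> alg_carrier K \<Longrightarrow> alg_norm K x = B x x \<odot> \<one>"
  using conj_mult_cancel [of x \<one>] by (simp add: alg_norm_def)

lemma norm_eq_one_iff: "x \<in> alg_carrier K \<Longrightarrow> alg_norm K x = \<one> \<longleftrightarrow> B x x = 1"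
proof
  assume x: "x \<in> alg_carrier K"
  assume "alg_norm K x = \<one>"
  then have "B (B x x \<odot> \<one>) \<one> = B \<one> \<one>"
    using x by (simp add: norm_eq)
  then show "B x x = 1"
    using x by simp
next
  assume x: "x \<in> alg_carrier K" and "B x x = 1"
  then show "alg_norm K x = \<one>"
    by (intro form_eqI) (simp_all add: norm_eq)
qed

text \<open>Moving the left factor \<open>x\<close> across the form produces
  \<open>cj x (x y)\<close>, which cancels.\<close>

lemma form_mult: "\<lbrakk>x \<in> alg_carrier K; y \<in> alg_carrier K\<rbrakk> \<Longrightarrow> B (x \<otimes> y) (x \<otimes> y) = B x x * B y y"
  by (simp add: mult_adjoint)

lemma alg_inv_eq:
  assumes x: "x \<in> alg_carrier K" "x \<noteq> \<zero>"
  shows "alg_inv K x = inverse (B x x) \<odot> cj x"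
  unfolding alg_inv_def
proof (rule the_equality)
  have pos: "B x x \<noteq> 0"
    using form_pos [OF x] by simp
  have "cj x \<otimes> x = B x x \<odot> \<one>" "x \<otimes> cj x = B x x \<odot> \<one>"
    using conj_mult_cancel [of x \<one>] conj_mult_cancel' [of x \<one>] x by simp_all
  then show "inverse (B x x) \<odot> cj x \<in> alg_carrier K \<and> x \<otimes> (inverse (B x x) \<odot> cj x) = \<one>
      \<and> (inverse (B x x) \<odot> cj x) \<otimes> x = \<one>"
    using x pos by (auto simp: mult_linear intro!: form_eqI)
  show "y = inverse (B x x) \<odot> cj x"
    if "y \<in> alg_carrier K \<and> x \<otimes> y = \<one> \<and> y \<otimes> x = \<one>" for y
  proof -
    \<comment> \<open>Lacking associativity, uniqueness comes from applying \<open>cj x\<close> to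
      \<open>x y = 1\<close>.\<close>
    from that have y: "y \<in> alg_carrier K" and "cj x \<otimes> (x \<otimes> y) = cj x"
      using x by simp_all
    then have "cj x = B x x \<odot> y"
      using x by simp
    then show ?thesis
      using x y pos by (intro form_eqI) simp_all
  qed
qed

section \<open>The twisted multiplication\<close>

text \<open>The operator T of the outline. If conjugation reversed products, this would be right
  multiplication by \<open>cj b\<close>.\<close>

definition twist :: "'a \<Rightarrow> 'a \<Rightarrow> 'a" where
  "twist b x = cj (b \<otimes> cj x)"

lemma twist_closed [simp]: "\<lbrakk>b \<in> alg_carrier K; x \<in> alg_carrier K\<rbrakk> \<Longrightarrow> twist b x \<in> alg_carrier K"
  by (simp add: twist_def)

lemma twist_cancel [simp]:
  "\<lbrakk>b \<in> alg_carrier K; x \<in> alg_carrier K\<rbrakk> \<Longrightarrow> twist (cj b) (twist b x) = B b b \<odot> x"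
  "\<lbrakk>b \<in> alg_carrier K; x \<in> alg_carrier K\<rbrakk> \<Longrightarrow> twist b (twist (cj b) x) = B b b \<odot> x"
  by (simp_all add: twist_def conj_linear)

lemma twist_linear:
  assumes "b \<in> alg_carrier K" "x \<in> alg_carrier K" "y \<in> alg_carrier K"
  shows "twist b (x \<oplus> y) = twist b x \<oplus> twist b y" "twist b (r \<odot> x) = r \<odot> twist b x"
    "twist b (\<ominus> x) = \<ominus> twist b x" "twist b \<zero> = \<zero>"
  using assms by (simp_all add: twist_def conj_linear mult_linear)

lemma twist_neg:
  "\<lbrakk>b \<in> alg_carrier K; x \<in> alg_carrier K\<rbrakk> \<Longrightarrow> twist (\<ominus> b) x = \<ominus> twist b x"
  "\<lbrakk>b \<in> alg_carrier K; x \<in> alg_carrier K\<rbrakk> \<Longrightarrow> twist (cj (\<ominus> b)) x = \<ominus> twist (cj b) x"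
  by (simp_all add: twist_def conj_linear neg_mult)

lemma twist_one [simp]: "b \<in> alg_carrier K \<Longrightarrow> twist b \<one> = cj b"
  by (simp add: twist_def)

lemma twist_scale:
  assumes "b \<in> alg_carrier K" "x \<in> alg_carrier K"
  shows "twist (r \<odot> b) x = r \<odot> twist b x" "twist (cj (r \<odot> b)) x = r \<odot> twist (cj b) x"
  using assms by (simp_all add: twist_def conj_linear)

lemma twist_adjoint:
  assumes "b \<in> alg_carrier K" "x \<in> alg_carrier K" "y \<in> alg_carrier K"
  shows "B (twist (cj b) x) y = B x (twist b y)" "B x (twist (cj b) y) = B (twist b x) y"
  using assms by (simp_all add: twist_def form_conj mult_adjoint)

lemma zero_mult: "x \<in> alg_carrier K \<Longrightarrow> \<zero> \<otimes> x = \<zero>"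
proof -
  assume x: "x \<in> alg_carrier K"
  have "\<zero> = 0 \<odot> \<zero>"
    by (intro form_eqI) simp_all
  then have "\<zero> \<otimes> x = 0 \<odot> (\<zero> \<otimes> x)"
    using scale_mult [OF zero_closed x] by metis
  then show ?thesis
    using x by (metis form_eqI form_scale form_zero mult_closed mult_zero_left zero_closed)
qed

text \<open>The product of the double branches on whether a component vanishes, so zero must be
  recognised after scaling.\<close>

lemma scale_eq_zero_iff: "x \<in> alg_carrier K \<Longrightarrow> r \<odot> x = \<zero> \<longleftrightarrow> r = 0 \<or> x = \<zero>"
proof
  assume x: "x \<in> alg_carrier K" and "r \<odot> x = \<zero>"
  then have "r * B x x = 0"
    by (metis form_scale form_zero)
  then show "r = 0 \<or> x = \<zero>"
    using form_pos [OF x] by auto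
next
  assume "x \<in> alg_carrier K" "r = 0 \<or> x = \<zero>"
  then show "r \<odot> x = \<zero>"
    by (auto intro!: form_eqI)
qed

lemma neg_eq_zero_iff: "x \<in> alg_carrier K \<Longrightarrow> \<ominus> x = \<zero> \<longleftrightarrow> x = \<zero>"
proof
  assume "x \<in> alg_carrier K" "\<ominus> x = \<zero>"
  then have "- B x x = 0"
    by (metis form_neg form_zero)
  then show "x = \<zero>"
    using \<open>x \<in> alg_carrier K\<close> form_pos [of x] by auto
next
  assume "x \<in> alg_carrier K" "x = \<zero>"
  then show "\<ominus> x = \<zero>"
    by (intro form_eqI) simp_all
qed

section \<open>Norm one and the equation \<open>cj b a = b\<close>\<close>

lemma conj_mult_fixed_imp_norm:
  assumes a: "a \<in> alg_carrier K" and b: "b \<in> alg_carrier K" "b \<noteq> \<zero>" and eq: "cj b \<otimes> a = b"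
  shows "B a a = 1"
proof -
  have "B b b * B a a = B b b"
    using form_mult [of "cj b" a] a b(1) eq by simp
  then show ?thesis
    using form_pos [OF b] by simp
qed

text \<open>The quadratic equation with trace and norm: expand \<open>b (cj b) = n(b) 1\<close> by
  the trace formula for \<open>cj b\<close>.\<close>

lemma square_eq:
  assumes b: "b \<in> alg_carrier K"
  shows "b \<otimes> b = (2 * B \<one> b) \<odot> b \<oplus> \<ominus> (B b b \<odot> \<one>)"
proof (rule form_eqI)
  fix z assume z: "z \<in> alg_carrier K"
  have "B (b \<otimes> cj b) z = B b b * B \<one> z"
    using conj_mult_cancel' [OF b one_closed] b z by simp
  moreover have "b \<otimes> cj b = (2 * B \<one> b) \<odot> b \<oplus> \<ominus> (b \<otimes> b)"
    using b by (simp add: conj_trace mult_linear)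
  ultimately show "B (b \<otimes> b) z = B ((2 * B \<one> b) \<odot> b \<oplus> \<ominus> (B b b \<odot> \<one>)) z"
    using b z by simp
qed (use b in simp_all)

lemma conj_mult_fixed_if_square:
  assumes a: "a \<in> alg_carrier K" and b: "b \<in> alg_carrier K" "b \<noteq> \<zero>" and sq: "b \<otimes> b = B b b \<odot> a"
  shows "cj b \<otimes> a = b"
proof (rule scale_cancel)
  show "B b b \<odot> (cj b \<otimes> a) = B b b \<odot> b"
    using conj_mult_cancel [OF b(1) b(1)] a b(1) by (simp only: sq mult_linear conj_closed)
  show "B b b \<noteq> 0"
    using form_pos [OF b] by simp
qed (use a b in simp_all)

lemma norm_one_imp_conj_mult_fixed:
  assumes a: "a \<in> alg_carrier K" and norm: "B a a = 1"
    and imag: "u \<in> alg_carrier K" "u \<noteq> \<zero>" "cj u = \<ominus> u"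
  shows "\<exists>b \<in> alg_carrier K. b \<noteq> \<zero> \<and> cj b \<otimes> a = b"
proof (cases "\<one> \<oplus> a = \<zero>")
  case True
  have "B a z = - B \<one> z" if "z \<in> alg_carrier K" for z
  proof -
    have "B (\<one> \<oplus> a) z = 0"
      using True that by simp
    then show ?thesis
      using a that by (simp add: add_eq_0_iff)
  qed
  then have "a = \<ominus> \<one>"
    using a by (intro form_eqI) simp_all
  then have "cj u \<otimes> a = u"
    using imag by (simp add: mult_linear neg_mult) (auto intro: form_eqI)
  then show ?thesis
    using imag by blast
next
  case False
  let ?b = "\<one> \<oplus> a"
  have b: "?b \<in> alg_carrier K"
    using a by simp
  \<comment> \<open>As \<open>n(a) = 1\<close>, both \<open>n(b)\<close> and the trace
    \<open>2 B 1 b\<close> equal \<open>2 + 2 B 1 a\<close>, so \<open>square_eq\<close> collapses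
    to \<open>n(b) (b - 1) = n(b) a\<close>.\<close>
  have "?b \<otimes> ?b = B ?b ?b \<odot> a"
    using a norm by (intro form_eqI) (simp_all add: square_eq form_sym [of a \<one>] algebra_simps)
  then show ?thesis
    using conj_mult_fixed_if_square [OF a b False] b False by blast
qed

end

section \<open>The form on the double\<close>

text \<open>The orthogonal sum of two copies of \<open>B\<close>, the second scaled by
  \<open>- D\<close>, which is positive for negative \<open>D\<close>.\<close>

fun double_form :: "'k::comm_ring \<Rightarrow> ('k tree \<Rightarrow> 'k tree \<Rightarrow> 'k) \<Rightarrow> 'k tree \<Rightarrow> 'k tree \<Rightarrow> 'k" where
  "double_form D B (Couple a b) (Couple c d) = B a c - D * B b d"
| "double_form D B _ _ = 0"

lemma conway_smith_double_simps [simp]: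
  "Couple a b \<in> alg_carrier (conway_smith_double D K) \<longleftrightarrow> a \<in> alg_carrier K \<and> b \<in> alg_carrier K"
  "alg_zero (conway_smith_double D K) = Couple (alg_zero K) (alg_zero K)"
  "alg_one (conway_smith_double D K) = Couple (alg_one K) (alg_zero K)"
  "alg_add (conway_smith_double D K) = double_add K"
  "alg_neg (conway_smith_double D K) = double_neg K"
  "alg_scale (conway_smith_double D K) = double_scale K"
  "alg_mult (conway_smith_double D K) = double_mult D K"
  "alg_conj (conway_smith_double D K) = double_conj K"
  by (simp_all add: conway_smith_double_def)

lemma conway_smith_double_cases:
  assumes "x \<in> alg_carrier (conway_smith_double D K)"
  obtains a b where "x = Couple a b" "a \<in> alg_carrier K" "b \<in> alg_carrier K"
  using assms by (auto simp: conway_smith_double_def)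

declare double_mult.simps [simp del]

locale euclidean_conj_algebra_tree =
  euclidean_conj_algebra K B
  for K :: "('k::linordered_field, 'k tree) conj_algebra" (structure)
    and B :: "'k tree \<Rightarrow> 'k tree \<Rightarrow> 'k"
begin

text \<open>By \<open>alg_inv_eq\<close> the conjugate of the inverse of \<open>b\<close> is
  \<open>b\<close> divided by \<open>n(b)\<close>; linearity of \<open>twist (cj b)\<close> then
  joins the two summands.\<close>

lemma double_mult_eq:
  assumes "a \<in> alg_carrier K" "b \<in> alg_carrier K" "c \<in> alg_carrier K" "d \<in> alg_carrier K"
  shows "double_mult D K (Couple a b) (Couple c d) =
    (if b \<noteq> \<zero> then
       Couple (a \<otimes> c \<oplus> D \<odot> twist b d)
         (twist (cj b) (c \<oplus> inverse (B b b) \<odot> (cj a \<otimes> twist b d)))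
     else Couple (a \<otimes> c) (cj a \<otimes> d))"
  using assms
  by (simp add: double_mult.simps alg_inv_eq twist_def conj_linear mult_linear)

lemma euclidean_double:
  assumes D: "D < 0"
  shows "euclidean_conj_algebra (conway_smith_double D K) (double_form D B)"
proof -
  let ?L = "conway_smith_double D K"
  show ?thesis
  proof
    fix x y
    assume "x \<in> alg_carrier ?L" "y \<in> alg_carrier ?L" "x \<oplus>\<^bsub>?L\<^esub> \<ominus>\<^bsub>?L\<^esub> y = \<zero>\<^bsub>?L\<^esub>"
    then show "x = y"
      by (elim conway_smith_double_cases) (simp add: eq_if_diff_zero)
  next
    fix x y
    assume "x \<in> alg_carrier ?L" "y \<in> alg_carrier ?L"
    then show "double_form D B x y = double_form D B y x"
      by (elim conway_smith_double_cases) (simp add: form_sym)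
  next
    fix x
    assume "x \<in> alg_carrier ?L" "x \<noteq> \<zero>\<^bsub>?L\<^esub>"
    then obtain a b where x: "x = Couple a b" "a \<in> alg_carrier K" "b \<in> alg_carrier K"
      and "a \<noteq> \<zero> \<or> b \<noteq> \<zero>"
      by (elim conway_smith_double_cases) auto
    from this(4) show "0 < double_form D B x x"
    proof
      assume "a \<noteq> \<zero>"
      then have "0 < B a a" "D * B b b \<le> 0"
        using x D form_pos form_nonneg by (simp_all add: mult_nonpos_nonneg)
      then show ?thesis
        using x(1) by simp
    next
      assume "b \<noteq> \<zero>"
      then have "0 \<le> B a a" "D * B b b < 0"
        using x D form_pos form_nonneg by (simp_all add: mult_neg_pos)
      then show ?thesis
        using x(1) by simp
    qed
  next
    fix x
    assume "x \<in> alg_carrier ?L"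
    then show "cj\<^bsub>?L\<^esub> x =
        (2 * double_form D B \<one>\<^bsub>?L\<^esub> x) \<odot>\<^bsub>?L\<^esub> \<one>\<^bsub>?L\<^esub> \<oplus>\<^bsub>?L\<^esub> \<ominus>\<^bsub>?L\<^esub> x"
      by (elim conway_smith_double_cases) (auto simp: conj_trace intro!: form_eqI)
  next
    fix x
    assume "x \<in> alg_carrier ?L"
    then show "x \<otimes>\<^bsub>?L\<^esub> \<one>\<^bsub>?L\<^esub> = x"
      by (elim conway_smith_double_cases)
         (auto simp: double_mult_eq twist_linear mult_linear intro!: form_eqI)
  next
    fix x y r
    assume "x \<in> alg_carrier ?L" "y \<in> alg_carrier ?L"
    then show "(r \<odot>\<^bsub>?L\<^esub> x) \<otimes>\<^bsub>?L\<^esub> y = r \<odot>\<^bsub>?L\<^esub> (x \<otimes>\<^bsub>?L\<^esub> y)"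
      \<comment> \<open>For \<open>r = 0\<close> the product switches to the other branch. Otherwise
        the factors \<open>r\<close> from \<open>cj a\<close> and \<open>twist b\<close> cancel
        against the inverse norm of \<open>r b\<close>.\<close>
      by (elim conway_smith_double_cases, cases "r = 0")
         (auto simp: double_mult_eq scale_eq_zero_iff zero_mult twist_linear twist_scale mult_linear
           conj_linear field_simps intro!: form_eqI)
  next
    fix x y z
    assume "x \<in> alg_carrier ?L" "y \<in> alg_carrier ?L" "z \<in> alg_carrier ?L"
    then show "double_form D B (x \<otimes>\<^bsub>?L\<^esub> y) z = double_form D B y (cj\<^bsub>?L\<^esub> x \<otimes>\<^bsub>?L\<^esub> z)"
      \<comment> \<open>Conjugation replaces \<open>a\<close> by \<open>cj a\<close> and
        \<open>b\<close> by \<open>- b\<close>; the adjointness of \<open>twist b\<close> and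
        \<open>twist (cj b)\<close> exchanges the two cross terms.\<close>
      by (elim conway_smith_double_cases)
         (auto simp: double_mult_eq neg_eq_zero_iff twist_linear twist_neg mult_linear
           twist_adjoint mult_adjoint algebra_simps)
  next
    fix x y
    assume "x \<in> alg_carrier ?L" "y \<in> alg_carrier ?L"
    then show "cj\<^bsub>?L\<^esub> x \<otimes>\<^bsub>?L\<^esub> (x \<otimes>\<^bsub>?L\<^esub> y) = double_form D B x x \<odot>\<^bsub>?L\<^esub> y"
    proof (elim conway_smith_double_cases)
      fix a b c d
      assume xy: "x = Couple a b" "y = Couple c d"
        and abcd: "a \<in> alg_carrier K" "b \<in> alg_carrier K" "c \<in> alg_carrier K" "d \<in> alg_carrier K"
      show ?thesis
      proof (cases "b = \<zero>")
        case True
        then show ?thesis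
          using abcd unfolding xy
          by (auto simp: double_mult_eq neg_eq_zero_iff intro!: form_eqI)
      next
        case False
        then have "B b b \<noteq> 0"
          using abcd form_pos [of b] by simp
        \<comment> \<open>With \<open>q\<close> the second component of \<open>x y\<close>,
          \<open>twist b q\<close> is \<open>n(b) c + cj a (twist b d)\<close>. The mixed terms
          cancel and leave the factor \<open>n(a) - D n(b)\<close>.\<close>
        with False show ?thesis
          using abcd unfolding xy
          by (auto simp: double_mult_eq neg_eq_zero_iff twist_linear twist_neg mult_linear
              field_simps intro!: form_eqI)
      qed
    qed
  qed (auto elim!: conway_smith_double_cases simp: double_mult_eq algebra_simps)
qed

end

section \<open>The tower\<close>

primrec tower_form :: "(nat \<Rightarrow> 'k::field) \<Rightarrow> nat \<Rightarrow> 'k tree \<Rightarrow> 'k tree \<Rightarrow> 'k" where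
  "tower_form D 0 = (\<lambda>x y. case (x, y) of (Scalar r, Scalar s) \<Rightarrow> r * s | _ \<Rightarrow> 0)"
| "tower_form D (Suc i) = double_form (D (Suc i)) (tower_form D i)"

text \<open>On the field, \<open>B 1 r = r\<close>, so the trace formula \<open>2 r - r\<close>
  gives the identity conjugation.\<close>

lemma euclidean_base:
  "euclidean_conj_algebra (base_algebra :: ('k::linordered_field, 'k tree) conj_algebra) (tower_form D 0)"
  \<comment> \<open>Reading \<open>r * r\<close> as a square settles positivity.\<close>
  by unfold_locales (auto simp: base_algebra_def algebra_simps simp flip: power2_eq_square)

lemma euclidean_tower:
  fixes D :: "nat \<Rightarrow> 'k::linordered_field"
  assumes "\<And>j. D j < 0"
  shows "euclidean_conj_algebra (tower D i) (tower_form D i)"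
proof (induction i)
  case 0
  show ?case
    using euclidean_base by simp
next
  case (Suc i)
  then interpret euclidean_conj_algebra_tree "tower D i" "tower_form D i"
    by (rule euclidean_conj_algebra_tree.intro)
  show ?case
    using euclidean_double assms by simp
qed

theorem corollary4:
  fixes D :: "nat \<Rightarrow> 'k::linordered_field" and i :: nat and a :: "'k tree"
  assumes "\<And>j. D j < 0"
    and "i \<ge> 1"
    and "a \<in> alg_carrier (tower D i)"
  shows "alg_norm (tower D i) a = alg_one (tower D i) \<longleftrightarrow>
    (\<exists>b \<in> alg_carrier (tower D i). b \<noteq> alg_zero (tower D i) \<and>
       alg_mult (tower D i) (alg_conj (tower D i) b) a = b)"
proof -
  interpret euclidean_conj_algebra "tower D i" "tower_form D i"
    using assms(1) by (rule euclidean_tower)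
  \<comment> \<open>Level 0 is excluded: there -1 has norm 1, but \<open>- b = b\<close> forces
    \<open>b = 0\<close>.\<close>
  obtain j where i: "i = Suc j"
    using assms(2) by (cases i) auto
  interpret K: euclidean_conj_algebra "tower D j" "tower_form D j"
    using assms(1) by (rule euclidean_tower)
  \<comment> \<open>The adjoined unit (0, 1) is purely imaginary and serves the case
    \<open>a = -1\<close>.\<close>
  let ?u = "Couple (alg_zero (tower D j)) (alg_one (tower D j))"
  have "alg_neg (tower D j) (alg_zero (tower D j)) = alg_zero (tower D j)"
    by (simp add: K.neg_eq_zero_iff)
  then have u: "?u \<in> alg_carrier (tower D i)" "?u \<noteq> alg_zero (tower D i)"
    "alg_conj (tower D i) ?u = alg_neg (tower D i) ?u"
    by (simp_all add: i K.one_neq_zero)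
  show ?thesis
    using norm_one_imp_conj_mult_fixed [OF assms(3) _ u] conj_mult_fixed_imp_norm [OF assms(3)]
    by (auto simp: norm_eq_one_iff [OF assms(3)])
qed

end
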